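(* Let $0<b<1<a$, let $\omega$ be the characteristic function of a semi-stable($a,b$) law on $\mathbf{R}$, and let $\varphi$ be the Laplace transform of a probability distribution on $[0,\infty)$. If $\varphi$ is selfdecomposable, then the $\varphi$-semi-stable($a,b$) law with characteristic function $s\mapsto\varphi\{-\ln\omega(s)\}$ is semi-selfdecomposable($b$); that is, there exists a characteristic function $f_o$ such that $\varphi\{-\ln\omega(s)\}=\varphi\{-\ln\omega(bs)\}\,f_o(s)$ for all $s\in\mathbf{R}$.
   Context: Semi-stability is understood in the strict sense. For $0<b<1<a$, a characteristic function $\omega$ is semi-stable($a,b$) if it is infinitely divisible and $\omega(u)=\exp\{-\psi(u)\}$ with $\psi(u)=a\psi(bu)$ for all $u\in\mathbf{R}$, where $-\psi=\ln\omega$ is the continuous logarithm with $\psi(0)=0$. The Laplace transform of a probability distribution $F$ on $[0,\infty)$ is $\varphi(z)=\int_{[0,\infty)}e^{-zt}\,dF(t)$, for complex $z$ with $\mathrm{Re}\,z\ge 0$. A Laplace transform $\varphi$ is selfdecomposable (SD) if for every $c\in(0,1)$ there is a Laplace transform $\varphi_c$ of a probability distribution on $[0,\infty)$ with $\varphi(s)=\varphi(cs)\varphi_c(s)$ for all $s>0$. A law with characteristic function $\varphi\{-\ln\omega(s)\}$, where $\omega$ is semi-stable($a,b$), is called $\varphi$-semi-stable($a,b$). For $b\in(0,1)$, a distribution on $\mathbf{R}$ with characteristic function $f$ is semi-selfdecomposable($b$), written semi-SD($b$), if there is a characteristic function $f_o$ with $f(s)=f(bs)f_o(s)$ for all $s\in\mathbf{R}$.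 *)

theory Defs
  imports "HOL-Probability.Probability"
begin

definition char_fun :: "(real \<Rightarrow> complex) \<Rightarrow> bool" where
  "char_fun f \<longleftrightarrow> (\<exists>M. real_distribution M \<and> f = char M)"

definition inf_divisible :: "(real \<Rightarrow> complex) \<Rightarrow> bool" where
  "inf_divisible f \<longleftrightarrow>
     char_fun f \<and> (\<forall>n::nat. n \<ge> 1 \<longrightarrow> (\<exists>g. char_fun g \<and> (\<forall>u. f u = g u ^ n)))"

text \<open>
  The continuous logarithm on the line normalised at \<open>0\<close>; it is in general not the
  composition with the principal branch \<^const>\<open>Ln\<close>. Lemma \<open>cont_ln_eq\<close> below shows that
  it is unique whenever it exists, so the definite description is meaningful.
\<close>

definition is_cont_ln :: "(real \<Rightarrow> complex) \<Rightarrow> (real \<Rightarrow> complex) \<Rightarrow> bool" where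
  "is_cont_ln f L \<longleftrightarrow> continuous_on UNIV L \<and> L 0 = 0 \<and> (\<forall>u. f u = exp (L u))"

definition cont_ln :: "(real \<Rightarrow> complex) \<Rightarrow> real \<Rightarrow> complex" where
  "cont_ln f = (THE L. is_cont_ln f L)"

lemma is_cont_ln_unique:
  assumes L: "is_cont_ln f L" and L': "is_cont_ln f L'"
  shows "L = L'"
proof -
  define D where "D = (\<lambda>u. (L u - L' u) / (2 * of_real pi * \<i>))"
  have cont: "continuous_on UNIV D"
    using L L' unfolding D_def is_cont_ln_def by (intro continuous_intros) auto
  have int: "D u \<in> \<int>" for u
  proof -
    have "exp (L u) = exp (L' u)"
      using L L' by (simp add: is_cont_ln_def)
    then obtain n :: int where "L u = L' u + (of_int (2 * n) * pi) * \<i>"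
      by (auto simp: exp_eq)
    then have "D u = of_int n"
      by (simp add: D_def field_simps)
    then show ?thesis by simp
  qed
  have "D constant_on UNIV"
  proof (rule continuous_discrete_range_constant[OF _ cont])
    fix x :: real
    have "1 \<le> norm (D y - D x)" if "D y \<noteq> D x" for y
    proof -
      from int[of x] int[of y] obtain m n :: int where "D x = of_int m" "D y = of_int n"
        by (auto elim!: Ints_cases)
      moreover from this that have "1 \<le> \<bar>n - m\<bar>" by auto
      ultimately show ?thesis
        by (metis norm_of_int of_int_1_le_iff of_int_abs of_int_diff)
    qed
    then show "\<exists>e>0. \<forall>y. y \<in> UNIV \<and> D y \<noteq> D x \<longrightarrow> e \<le> norm (D y - D x)"
      by (intro exI[of _ 1]) auto
  qed simp
  then obtain c where c: "\<And>u. D u = c"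
    by (auto simp: constant_on_def)
  have "D 0 = 0"
    using L L' by (simp add: D_def is_cont_ln_def)
  with c have "D u = 0" for u by metis
  then show ?thesis by (auto simp: D_def)
qed

lemma cont_ln_eq: "is_cont_ln f L \<Longrightarrow> cont_ln f = L"
  unfolding cont_ln_def by (blast intro: is_cont_ln_unique)

definition semi_stable :: "real \<Rightarrow> real \<Rightarrow> (real \<Rightarrow> complex) \<Rightarrow> bool" where
  "semi_stable a b \<omega> \<longleftrightarrow>
     inf_divisible \<omega> \<and>
     (\<exists>\<psi>. is_cont_ln \<omega> (\<lambda>u. - \<psi> u) \<and> (\<forall>u. \<psi> u = complex_of_real a * \<psi> (b * u)))"

definition nonneg_distribution :: "real measure \<Rightarrow> bool" where
  "nonneg_distribution F \<longleftrightarrow> real_distribution F \<and> measure F {0..} = 1"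

definition laplace :: "real measure \<Rightarrow> complex \<Rightarrow> complex" where
  "laplace F z = (LINT t:{0..}|F. exp (- (z * complex_of_real t)))"

text \<open>A Laplace transform is only constrained on the closed right half-plane.\<close>

definition laplace_transform :: "(complex \<Rightarrow> complex) \<Rightarrow> bool" where
  "laplace_transform \<phi> \<longleftrightarrow>
     (\<exists>F. nonneg_distribution F \<and> (\<forall>z. Re z \<ge> 0 \<longrightarrow> \<phi> z = laplace F z))"

definition selfdecomposable :: "(complex \<Rightarrow> complex) \<Rightarrow> bool" where
  "selfdecomposable \<phi> \<longleftrightarrow>
     laplace_transform \<phi> \<and>
     (\<forall>c::real. 0 < c \<and> c < 1 \<longrightarrow>
       (\<exists>\<phi>\<^sub>c. laplace_transform \<phi>\<^sub>c \<and>
         (\<forall>s::real. s > 0 \<longrightarrow>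
            \<phi> (complex_of_real s) = \<phi> (complex_of_real (c * s)) * \<phi>\<^sub>c (complex_of_real s))))"

definition semi_selfdecomposable :: "real \<Rightarrow> (real \<Rightarrow> complex) \<Rightarrow> bool" where
  "semi_selfdecomposable b f \<longleftrightarrow>
     char_fun f \<and> (\<exists>f\<^sub>o. char_fun f\<^sub>o \<and> (\<forall>s. f s = f (b * s) * f\<^sub>o s))"

end

theory Submission
  imports Defs "HOL-Complex_Analysis.Conformal_Mappings"
begin

text \<open>
  Semi-stability gives \<open>\<psi> (b s) = \<psi> s / a\<close>, so selfdecomposability with \<open>c = 1 / a\<close>, continued
  analytically to the closed right half-plane, yields
  \<open>\<phi> (\<psi> s) = \<phi> (\<psi> (b s)) \<phi>\<^sub>c (\<psi> s)\<close>. It remains to see that \<open>\<phi>\<^sub>c \<circ> \<psi>\<close> is a characteristic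
  function: it is the limit, as \<open>n \<rightarrow> \<infinity>\<close>, of the countable mixtures of the powers
  \<open>exp (- (k / n) \<psi>)\<close> with weights the mass of \<open>[k / n, (k + 1) / n)\<close>, and these powers are
  characteristic functions by infinite divisibility.
\<close>

section \<open>Closure of characteristic functions under products, powers and countable
  mixtures\<close>

lemma char_fun_char: "real_distribution M \<Longrightarrow> char_fun (char M)"
  by (auto simp: char_fun_def)

lemma char_fun_one: "char_fun (\<lambda>_. 1)"
proof -
  interpret R: prob_space "return borel (0::real)"
    by (rule prob_space_return) simp
  have "real_distribution (return borel (0::real))"
    by unfold_locales auto
  moreover have "char (return borel 0) = (\<lambda>_. 1)"
    by (auto simp: char_def integral_return)
  ultimately show ?thesis unfolding char_fun_def by metis
qed

text \<open>The product belongs to the sum of two independent variables, realised on the product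
  space.\<close>

lemma char_fun_mult:
  assumes "char_fun f" "char_fun g"
  shows "char_fun (\<lambda>s. f s * g s)"
proof -
  from assms obtain M N where M: "real_distribution M" "f = char M"
    and N: "real_distribution N" "g = char N"
    by (auto simp: char_fun_def)
  interpret M: real_distribution M by fact
  interpret N: real_distribution N by fact
  interpret P: pair_prob_space M N ..
  let ?D = "distr (M \<Otimes>\<^sub>M N) borel (\<lambda>p. fst p + snd p)"
  have "real_distribution ?D"
    by (rule P.real_distribution_distr) simp
  moreover have "char ?D = (\<lambda>s. f s * g s)"
  proof
    fix s
    have "char ?D s = (LINT p|(M \<Otimes>\<^sub>M N). iexp (s * (fst p + snd p)))"
      unfolding char_def by (subst integral_distr) auto
    also have "\<dots> = (LINT x|M. LINT y|N. iexp (s * (x + y)))"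
      by (subst P.integral_fst'[symmetric]) (auto intro!: P.integrable_const_bound[where B = 1])
    also have "\<dots> = (LINT x|M. LINT y|N. iexp (s * x) * iexp (s * y))"
      by (simp add: distrib_left exp_add)
    also have "\<dots> = f s * g s"
      by (simp add: M N char_def)
    finally show "char ?D s = f s * g s" .
  qed
  ultimately show ?thesis unfolding char_fun_def by metis
qed

lemma char_fun_power: "char_fun f \<Longrightarrow> char_fun (\<lambda>s. f s ^ n)"
  by (induction n) (auto intro: char_fun_one char_fun_mult)

text \<open>Draw \<open>t\<close> from \<open>P\<close> and, independently, a sequence
  \<open>x\<close> of independent coordinates with laws \<open>N i\<close>. Given \<open>t\<close>,
  the coordinate \<open>x (k t)\<close> has characteristic function \<open>g (k t)\<close>, so
  Fubini gives the mixture.\<close>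

lemma char_fun_mixture:
  fixes g :: "nat \<Rightarrow> real \<Rightarrow> complex"
  assumes "prob_space P" and k[measurable]: "k \<in> measurable P (count_space UNIV)"
    and g: "\<And>i. char_fun (g i)"
  shows "char_fun (\<lambda>s. LINT t|P. g (k t) s)"
proof -
  from g obtain N where N: "\<And>i. real_distribution (N i)" "\<And>i. g i = char (N i)"
    unfolding char_fun_def by metis
  interpret P: prob_space P by fact
  interpret N: real_distribution "N i" for i by (rule N)
  interpret Q: product_prob_space N UNIV ..
  interpret PQ: pair_prob_space P "PiM UNIV N" ..
  let ?X = "\<lambda>p. snd p (k (fst p))"
  have [measurable_cong]: "sets (N i) = sets borel" for i
    by simp
  \<comment> \<open>Evaluation at a random index is measurable because there are only countably many
    indices.\<close>
  have [measurable]: "?X \<in> borel_measurable (P \<Otimes>\<^sub>M PiM UNIV N)"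
    by (rule measurable_compose_countable[where g = "\<lambda>p. k (fst p)" and f = "\<lambda>i p. snd p i"])
       measurable
  let ?D = "distr (P \<Otimes>\<^sub>M PiM UNIV N) borel ?X"
  have "real_distribution ?D"
    by (rule PQ.real_distribution_distr) simp
  moreover have "char ?D = (\<lambda>s. LINT t|P. g (k t) s)"
  proof
    fix s
    have *: "(LINT x|(PiM UNIV N). iexp (s * x i)) = g i s" for i
    proof -
      have "g i s = (LINT y|distr (PiM UNIV N) (N i) (\<lambda>x. x i). iexp (s * y))"
        by (simp add: Q.PiM_component N char_def)
      also have "\<dots> = (LINT x|(PiM UNIV N). iexp (s * x i))"
        by (rule integral_distr) auto
      finally show ?thesis ..
    qed
    have "char ?D s = (LINT p|(P \<Otimes>\<^sub>M PiM UNIV N). iexp (s * ?X p))"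
      unfolding char_def by (subst integral_distr) auto
    also have "\<dots> = (LINT t|P. LINT x|(PiM UNIV N). iexp (s * x (k t)))"
      by (subst PQ.integral_fst'[symmetric]) (auto intro!: PQ.integrable_const_bound[where B = 1])
    also have "\<dots> = (LINT t|P. g (k t) s)"
      by (simp only: *)
    finally show "char ?D s = (LINT t|P. g (k t) s)" .
  qed
  ultimately show ?thesis unfolding char_fun_def by metis
qed

section \<open>Tightness and the continuity theorem for characteristic functions\<close>

text \<open>Fubini for the symmetric kernel \<open>iexp (d * u * x)\<close>. With \<open>N\<close>
  Gaussian it turns a Gaussian average of \<open>char M\<close> into an integral of a Gaussian
  function against \<open>M\<close>.\<close>

lemma integral_char_swap:
  assumes "real_distribution M" "real_distribution N"
  shows "(LINT u|N. char M (d * u)) = (LINT x|M. char N (d * x))"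
proof -
  interpret M: real_distribution M by fact
  interpret N: real_distribution N by fact
  interpret P: pair_prob_space M N ..
  have "integrable (M \<Otimes>\<^sub>M N) (\<lambda>(x, u). iexp (d * u * x))"
    by (auto intro!: P.integrable_const_bound[where B = 1])
  from P.Fubini_integral[OF this] show ?thesis
    by (simp add: char_def mult_ac)
qed

text \<open>
  Smoothing with a Gaussian turns the behaviour of the characteristic function near \<open>0\<close> into
  a tail bound, since \<open>1 - exp (- (d * x)\<^sup>2 / 2) \<ge> 1 / 2\<close> as soon as \<open>\<bar>d * x\<bar> \<ge> 2\<close>.
\<close>

lemma tail_le_char_smoothing:
  assumes "real_distribution M" "0 < d"
  shows "measure M {x. 2 / d \<le> \<bar>x\<bar>} \<le> 2 * (LINT u|std_normal_distribution. 1 - Re (char M (d * u)))"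
proof -
  interpret M: real_distribution M by fact
  let ?N = "std_normal_distribution"
  interpret N: real_distribution ?N by (rule real_dist_normal_dist)
  let ?e = "\<lambda>x. exp (- ((d * x)\<^sup>2) / 2) :: real"
  have intc: "integrable ?N (\<lambda>u. char M (d * u))"
    by (auto intro!: N.integrable_const_bound[where B = 1] M.cmod_char_le_1)
  have inte: "integrable M ?e"
    by (auto intro!: M.integrable_const_bound[where B = 1])
  have "(LINT u|?N. char M (d * u)) = (LINT x|M. complex_of_real (?e x))"
    using integral_char_swap[OF assms(1) real_dist_normal_dist, of d]
    by (simp add: char_std_normal_distribution)
  also have "\<dots> = complex_of_real (LINT x|M. ?e x)"
    by simp
  finally have "Re (LINT u|?N. char M (d * u)) = (LINT x|M. ?e x)"
    by simp
  then have eq: "(LINT u|?N. 1 - Re (char M (d * u))) = 1 - (LINT x|M. ?e x)"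
    using intc by (simp add: N.prob_space[simplified] integral_Re)
  have "measure M {x. 2 / d \<le> \<bar>x\<bar>} = (LINT x|M. indicator {x. 2 / d \<le> \<bar>x\<bar>} x)"
    by simp
  also have "\<dots> \<le> (LINT x|M. 2 * (1 - ?e x))"
  proof (rule integral_mono)
    show "indicator {x. 2 / d \<le> \<bar>x\<bar>} x \<le> 2 * (1 - ?e x)" for x
    proof (cases "2 / d \<le> \<bar>x\<bar>")
      case True
      then have "2 \<le> \<bar>d * x\<bar>"
        using \<open>0 < d\<close> by (simp add: field_simps abs_mult)
      then have "2\<^sup>2 \<le> (d * x)\<^sup>2"
        by (metis abs_le_square_iff abs_numeral)
      \<comment> \<open>The exponent is even at most -2; the weaker bound \<open>exp (- 1)\<close>
        suffices, as \<open>exp 1\<close> is at least 2.\<close>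
      then have "?e x \<le> exp (- 1)" by simp
      also have "\<dots> \<le> 1 / 2"
        using exp_ge_add_one_self[of 1] by (simp add: exp_minus field_simps)
      finally show ?thesis using True by simp
    qed simp
    show "integrable M (indicat_real {x. 2 / d \<le> \<bar>x\<bar>})"
      by (auto intro!: M.integrable_const_bound[where B = 1] simp: indicator_def)
    show "integrable M (\<lambda>x. 2 * (1 - ?e x))"
      using inte by simp
  qed
  also have "\<dots> = 2 * (1 - (LINT x|M. ?e x))"
    using inte by (simp add: M.prob_space[simplified])
  finally show ?thesis using eq by simp
qed

text \<open>Dominated convergence: the arguments shrink to 0, where \<open>g\<close> is continuous
  with value 1. Stated for a general \<open>g\<close> in order to cover both characteristic
  functions and their pointwise limit.\<close>

lemma smoothing_defect_tendsto_0:
  fixes g :: "real \<Rightarrow> complex"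
  assumes [measurable]: "g \<in> borel_measurable borel"
    and le: "\<And>u. norm (g u) \<le> 1" and "g 0 = 1" "isCont g 0"
  shows "(\<lambda>k. LINT u|std_normal_distribution. 1 - Re (g (1 / real (Suc k) * u))) \<longlonglongrightarrow> 0"
proof -
  let ?N = "std_normal_distribution"
  interpret N: real_distribution ?N by (rule real_dist_normal_dist)
  have "(\<lambda>k. LINT u|?N. 1 - Re (g (1 / real (Suc k) * u))) \<longlonglongrightarrow> (LINT u|?N. 0)"
  proof (rule integral_dominated_convergence[where w = "\<lambda>_. 2"])
    show "AE u in ?N. (\<lambda>k. 1 - Re (g (1 / real (Suc k) * u))) \<longlonglongrightarrow> 0"
    proof (rule AE_I2)
      fix u
      have "(\<lambda>k. 1 / real (Suc k) * u) \<longlonglongrightarrow> 0 * u"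
        by (intro tendsto_intros LIMSEQ_Suc[OF lim_1_over_n])
      then have "(\<lambda>k. g (1 / real (Suc k) * u)) \<longlonglongrightarrow> g 0"
        using isCont_tendsto_compose[OF \<open>isCont g 0\<close>] by simp
      then have "(\<lambda>k. 1 - Re (g (1 / real (Suc k) * u))) \<longlonglongrightarrow> 1 - Re (g 0)"
        by (intro tendsto_intros)
      then show "(\<lambda>k. 1 - Re (g (1 / real (Suc k) * u))) \<longlonglongrightarrow> 0"
        using \<open>g 0 = 1\<close> by simp
    qed
    show "AE u in ?N. norm (1 - Re (g (1 / real (Suc k) * u))) \<le> 2" for k
    proof (rule AE_I2)
      fix u
      have "\<bar>Re (g (1 / real (Suc k) * u))\<bar> \<le> 1"
        using abs_Re_le_cmod le order_trans by blast
      then show "norm (1 - Re (g (1 / real (Suc k) * u))) \<le> 2" by simp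
    qed
  qed auto
  then show ?thesis by simp
qed

text \<open>Tails are controlled by the smoothing defect \<open>T\<close>. A scale \<open>k0\<close>
  that is good for the limit \<open>g\<close> is good for all large \<open>n\<close> by dominated
  convergence; each of the finitely many other \<open>n\<close> gets a scale of its own, and the
  largest scale serves all.\<close>

lemma tight_if_char_tendsto:
  assumes M: "\<And>n. real_distribution (M n)"
    and lim: "\<And>s. (\<lambda>n. char (M n) s) \<longlonglongrightarrow> g s" and g: "isCont g 0"
  shows "tight M"
proof -
  interpret M: real_distribution "M n" for n by (rule M)
  let ?N = "std_normal_distribution"
  interpret N: real_distribution ?N by (rule real_dist_normal_dist)
  define T where "T h k = (LINT u|?N. 1 - Re (h (1 / real (Suc k) * u)))" for h k
  have [measurable]: "g \<in> borel_measurable borel"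
    by (rule borel_measurable_LIMSEQ_metric[OF _ lim]) simp
  have gle: "norm (g u) \<le> 1" for u
    by (rule tendsto_upperbound[OF tendsto_norm[OF lim[of u]]]) (auto simp: M.cmod_char_le_1)
  have g0: "g 0 = 1"
    using lim[of 0] by (simp add: M.char_zero LIMSEQ_const_iff)
  have Tg: "T g \<longlonglongrightarrow> 0"
    unfolding T_def by (rule smoothing_defect_tendsto_0) (use gle g0 g in auto)
  have TM: "T (char (M n)) \<longlonglongrightarrow> 0" for n
    unfolding T_def
    by (rule smoothing_defect_tendsto_0) (auto simp: M.cmod_char_le_1 M.char_zero M.isCont_char)
  have conv: "(\<lambda>n. T (char (M n)) k) \<longlonglongrightarrow> T g k" for k
    unfolding T_def
  proof (rule integral_dominated_convergence[where w = "\<lambda>_. 2"])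
    show "AE u in ?N. (\<lambda>n. 1 - Re (char (M n) (1 / real (Suc k) * u)))
        \<longlonglongrightarrow> 1 - Re (g (1 / real (Suc k) * u))"
      by (intro AE_I2 tendsto_intros lim)
    show "AE u in ?N. norm (1 - Re (char (M n) (1 / real (Suc k) * u))) \<le> 2" for n
    proof (rule AE_I2)
      fix u
      have "\<bar>Re (char (M n) (1 / real (Suc k) * u))\<bar> \<le> 1"
        using abs_Re_le_cmod M.cmod_char_le_1 order_trans by blast
      then show "norm (1 - Re (char (M n) (1 / real (Suc k) * u))) \<le> 2" by simp
    qed
  qed auto
  \<comment> \<open>Here \<open>d = 1 / (k + 1)\<close>, so the threshold \<open>2 / d\<close> is
    \<open>2 * (k + 1)\<close>.\<close>
  have tail: "measure (M n) {x. 2 * real (Suc k) \<le> \<bar>x\<bar>} \<le> 2 * T (char (M n)) k" for n k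
    using tail_le_char_smoothing[OF M, of "1 / real (Suc k)" n] by (simp add: T_def)
  show ?thesis
    unfolding tight_def
  proof (intro conjI allI impI M)
    fix e :: real assume "0 < e"
    \<comment> \<open>Half of \<open>e\<close> compensates the factor 2 in
      \<open>tail\<close>.\<close>
    then have "0 < e / 2" by simp
    have "\<forall>\<^sub>F k in sequentially. T g k < e / 2"
      using order_tendstoD(2)[OF Tg \<open>0 < e / 2\<close>] .
    then obtain k0 where k0: "T g k0 < e / 2"
      by (auto simp: eventually_sequentially)
    obtain n0 where n0: "\<And>n. n \<ge> n0 \<Longrightarrow> T (char (M n)) k0 < e / 2"
      using order_tendstoD(2)[OF conv[of k0] k0] by (auto simp: eventually_sequentially)
    have "\<exists>k. T (char (M n)) k < e / 2" for n
      using order_tendstoD(2)[OF TM \<open>0 < e / 2\<close>, of n] by (auto simp: eventually_sequentially)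
    then obtain K where K: "\<And>n. T (char (M n)) (K n) < e / 2" by metis
    define R where "R = Max (insert k0 (K ` {..<n0}))"
    have "\<exists>k\<le>R. T (char (M n)) k < e / 2" for n
    proof (cases "n < n0")
      case True
      then show ?thesis using K by (intro exI[of _ "K n"]) (auto simp: R_def)
    next
      case False
      then show ?thesis using n0 by (intro exI[of _ k0]) (auto simp: R_def)
    qed
    then obtain k where k: "\<And>n. k n \<le> R" "\<And>n. T (char (M n)) (k n) < e / 2" by metis
    let ?r = "2 * real (Suc R)"
    have "1 - e < measure (M n) {-?r<..?r}" for n
    proof -
      have "measure (M n) (UNIV - {-?r<..?r}) \<le> measure (M n) {x. 2 * real (Suc (k n)) \<le> \<bar>x\<bar>}"
        using k(1)[of n] by (intro M.finite_measure_mono) (auto simp: abs_if)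
      also have "\<dots> < e"
        using tail[of n "k n"] k(2)[of n] by simp
      finally show ?thesis
        using M.prob_compl[of "{-?r<..?r}" n] by simp
    qed
    then show "\<exists>a b. a < b \<and> (\<forall>n. 1 - e < measure (M n) {a<..b})"
      by (intro exI[of _ "-?r"] exI[of _ ?r]) auto
  qed
qed

text \<open>The hard direction of Levy's continuity theorem: tightness yields a weakly convergent
  subsequence, and the characteristic function of its limit law must agree with
  \<open>g\<close>.\<close>

lemma char_fun_limit:
  assumes f: "\<And>n. char_fun (f n)" and lim: "\<And>s. (\<lambda>n. f n s) \<longlonglongrightarrow> g s" and "isCont g 0"
  shows "char_fun g"
proof -
  from f obtain M where M: "\<And>n. real_distribution (M n)" "\<And>n. f n = char (M n)"
    unfolding char_fun_def by metis
  have "tight M"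
    using M lim \<open>isCont g 0\<close> by (intro tight_if_char_tendsto) auto
  from tight_imp_convergent_subsubsequence[OF this strict_mono_id]
  obtain r D where r: "strict_mono r" "real_distribution D" "weak_conv_m (M \<circ> r) D"
    by auto
  have "g s = char D s" for s
  proof (rule LIMSEQ_unique)
    show "(\<lambda>n. char ((M \<circ> r) n) s) \<longlonglongrightarrow> char D s"
      by (rule levy_continuity1[OF _ r(2,3)]) (simp add: M(1))
    show "(\<lambda>n. char ((M \<circ> r) n) s) \<longlonglongrightarrow> g s"
      using LIMSEQ_subseq_LIMSEQ[OF lim r(1)] by (simp add: M o_def)
  qed
  then have "g = char D" by auto
  then show ?thesis using char_fun_char r(2) by simp
qed

section \<open>Roots of an infinitely divisible characteristic function\<close>

text \<open>Infinite divisibility provides some n-th root \<open>g\<close>. Its quotient by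
  \<open>exp (L u / n)\<close> is continuous with values among the n-th roots of unity, hence
  constant, and it is 1 at 0; so \<open>g\<close> is the root given by the continuous
  logarithm.\<close>

lemma char_fun_nth_root:
  assumes "inf_divisible \<omega>" and L: "is_cont_ln \<omega> L" and "n \<ge> 1"
  shows "char_fun (\<lambda>u. exp (L u / of_nat n))"
proof -
  from assms obtain g where g: "char_fun g" "\<And>u. \<omega> u = g u ^ n"
    unfolding inf_divisible_def by blast
  then obtain M where M: "real_distribution M" "g = char M"
    by (auto simp: char_fun_def)
  interpret M: real_distribution M by fact
  define D where "D u = g u / exp (L u / of_nat n)" for u
  have cont: "continuous_on UNIV D"
    using L unfolding D_def M is_cont_ln_def
    by (intro continuous_intros continuous_at_imp_continuous_on) (use \<open>n \<ge> 1\<close> in \<open>auto simp: M.isCont_char continuous_on_eq_continuous_at\<close>)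
  have "D u ^ n = 1" for u
  proof -
    have "exp (L u / of_nat n) ^ n = exp (L u)"
      using \<open>n \<ge> 1\<close> by (simp flip: exp_of_nat_mult)
    moreover have "g u ^ n = exp (L u)"
      using L g(2)[of u] by (simp add: is_cont_ln_def)
    ultimately have "g u ^ n / exp (L u / of_nat n) ^ n = 1"
      by (simp only: divide_self_if exp_not_eq_zero if_False)
    then show ?thesis
      by (simp only: D_def power_divide)
  qed
  then have "D ` UNIV \<subseteq> {z. z ^ n = 1}" by auto
  then have "finite (D ` UNIV)"
    by (rule finite_subset) (use \<open>n \<ge> 1\<close> in \<open>auto intro: finite_roots_unity\<close>)
  from continuous_finite_range_constant[OF connected_UNIV cont this]
  obtain c where c: "\<And>u. D u = c" by (auto simp: constant_on_def)
  have "D 0 = 1"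
    using L by (simp add: D_def M M.char_zero is_cont_ln_def)
  with c have "D u = 1" for u by metis
  then have "g = (\<lambda>u. exp (L u / of_nat n))"
    by (auto simp: D_def)
  with g(1) show ?thesis by simp
qed

section \<open>Laplace transforms on the closed right half-plane\<close>

text \<open>Truncating \<open>t\<close> at \<open>0\<close> makes the integrand bounded by \<open>1\<close> everywhere, not just almost everywhere.\<close>

lemma laplace_eq:
  assumes "nonneg_distribution F"
  shows "laplace F z = (LINT t|F. exp (- (z * complex_of_real (max 0 t))))"
proof -
  from assms interpret F: real_distribution F by (simp add: nonneg_distribution_def)
  have "AE t in F. t \<in> {0..}"
    using assms by (intro F.AE_prob_1) (simp add: nonneg_distribution_def)
  then show ?thesis
    unfolding laplace_def set_lebesgue_integral_def
    by (intro integral_cong_AE) (auto simp: max_def elim!: eventually_mono)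
qed

lemma norm_exp_minus_mult_le_1: "Re z \<ge> 0 \<Longrightarrow> t \<ge> 0 \<Longrightarrow> norm (exp (- (z * complex_of_real t))) \<le> 1"
  by simp

text \<open>Dominated convergence with bound 1. The limit point may lie on the imaginary axis,
  outside the domain of holomorphy shown below.\<close>

lemma laplace_tendsto:
  assumes F: "nonneg_distribution F" and Z: "\<And>n. Re (Z n) \<ge> 0" "Z \<longlonglongrightarrow> z"
  shows "(\<lambda>n. laplace F (Z n)) \<longlonglongrightarrow> laplace F z"
proof -
  from F interpret F: real_distribution F by (simp add: nonneg_distribution_def)
  show ?thesis
    unfolding laplace_eq[OF F]
  proof (rule integral_dominated_convergence[where w = "\<lambda>_. 1"])
    show "AE t in F. (\<lambda>n. exp (- (Z n * complex_of_real (max 0 t)))) \<longlonglongrightarrow> exp (- (z * complex_of_real (max 0 t)))"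
      by (intro AE_I2 tendsto_intros Z)
  qed (use Z in \<open>auto intro!: AE_I2 norm_exp_minus_mult_le_1 simp del: norm_exp_eq_Re\<close>)
qed

text \<open>The derivative in \<open>z\<close> has norm at most \<open>t * exp (- (r * t))\<close>,
  which is at most \<open>1 / r\<close> since \<open>r * t \<le> exp (r * t)\<close>. The bound is
  uniform in \<open>t\<close>, so it dominates difference quotients under the integral.\<close>

lemma exp_minus_mult_lipschitz:
  assumes "0 < r" "r \<le> Re w" "r \<le> Re z" "0 \<le> t"
  shows "norm (exp (- (w * complex_of_real t)) - exp (- (z * complex_of_real t))) \<le> norm (w - z) / r"
proof -
  have "norm (exp (- (w * complex_of_real t)) - exp (- (z * complex_of_real t))) \<le> (1 / r) * norm (w - z)"
  proof (rule field_differentiable_bound[where S = "{z. r \<le> Re z}"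
        and f' = "\<lambda>z. - (complex_of_real t) * exp (- (z * complex_of_real t))"])
    show "convex {z. r \<le> Re z}"
      by (rule convex_halfspace_Re_ge)
    show "norm (- (complex_of_real t) * exp (- (z * complex_of_real t))) \<le> 1 / r"
      if "z \<in> {z. r \<le> Re z}" for z
    proof -
      have "r * t \<le> Re z * t"
        using that assms by (intro mult_right_mono) auto
      then have "t * exp (- (Re z * t)) \<le> t * exp (- (r * t))"
        using \<open>0 \<le> t\<close> by (intro mult_left_mono) auto
      moreover have "r * t \<le> exp (r * t)"
        using exp_ge_add_one_self[of "r * t"] by linarith
      then have "t * exp (- (r * t)) \<le> 1 / r"
        using \<open>0 < r\<close> by (simp add: exp_minus field_simps)
      ultimately show ?thesis
        using \<open>0 \<le> t\<close> by (simp add: norm_mult)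
    qed
  qed (use assms in \<open>auto intro!: derivative_eq_intros\<close>)
  then show ?thesis by simp
qed

text \<open>Differentiation under the integral sign, with the derivative computed along sequences so
  that dominated convergence applies.\<close>

lemma laplace_holomorphic:
  assumes F: "nonneg_distribution F"
  shows "laplace F holomorphic_on {z. 0 < Re z}"
  unfolding holomorphic_on_open[OF open_halfspace_Re_gt]
proof safe
  fix z :: complex assume z: "0 < Re z"
  from F interpret F: real_distribution F by (simp add: nonneg_distribution_def)
  let ?r = "Re z / 2"
  let ?E = "\<lambda>z t. exp (- (z * complex_of_real (max 0 t)))"
  have int: "integrable F (?E w)" if "Re w \<ge> 0" for w
    using that by (auto intro!: F.integrable_const_bound[where B = 1] norm_exp_minus_mult_le_1
        simp del: norm_exp_eq_Re)
  define d where "d = (LINT t|F. - complex_of_real (max 0 t) * ?E z t)"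
  have "((\<lambda>w. (laplace F w - laplace F z) / (w - z)) \<longlongrightarrow> d) (at z)"
    unfolding tendsto_at_iff_sequentially
  proof safe
    fix X assume X: "\<forall>i. X i \<in> UNIV - {z}" "X \<longlonglongrightarrow> z"
    have "(\<lambda>i. Re (X i)) \<longlonglongrightarrow> Re z"
      by (intro tendsto_intros X)
    from order_tendstoD(1)[OF this, of ?r] obtain n0 where n0: "\<And>n. n \<ge> n0 \<Longrightarrow> ?r < Re (X n)"
      using z by (auto simp: eventually_sequentially)
    \<comment> \<open>Dropping the first \<open>n0\<close> terms keeps the sequence where the real
      part exceeds \<open>?r\<close>, as the Lipschitz bound requires.\<close>
    define Y where "Y i = X (i + n0)" for i
    have Y: "Y i \<noteq> z" "?r < Re (Y i)" "Re (Y i) \<ge> 0" for i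
      using X n0[of "i + n0"] z by (auto simp: Y_def)
    have Ylim: "Y \<longlonglongrightarrow> z"
      unfolding Y_def by (rule LIMSEQ_ignore_initial_segment[OF X(2)])
    have "(\<lambda>i. LINT t|F. (?E (Y i) t - ?E z t) / (Y i - z)) \<longlonglongrightarrow> d"
      unfolding d_def
    proof (rule integral_dominated_convergence[where w = "\<lambda>_. 1 / ?r"])
      show "AE t in F. (\<lambda>i. (?E (Y i) t - ?E z t) / (Y i - z)) \<longlonglongrightarrow> - complex_of_real (max 0 t) * ?E z t"
      proof (rule AE_I2)
        fix t
        have "((\<lambda>w. ?E w t) has_field_derivative (- complex_of_real (max 0 t) * ?E z t)) (at z)"
          by (auto intro!: derivative_eq_intros)
        then show "(\<lambda>i. (?E (Y i) t - ?E z t) / (Y i - z)) \<longlonglongrightarrow> - complex_of_real (max 0 t) * ?E z t"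
          unfolding has_field_derivative_iff tendsto_at_iff_sequentially
          using Y Ylim by (auto simp: o_def)
      qed
      show "AE t in F. norm ((?E (Y i) t - ?E z t) / (Y i - z)) \<le> 1 / ?r" for i
      proof (rule AE_I2)
        fix t
        have "norm (?E (Y i) t - ?E z t) \<le> norm (Y i - z) / ?r"
          using z Y(2)[of i] by (intro exp_minus_mult_lipschitz) auto
        then show "norm ((?E (Y i) t - ?E z t) / (Y i - z)) \<le> 1 / ?r"
          using Y(1)[of i] z by (simp add: norm_divide divide_simps mult_ac)
      qed
    qed auto
    also have "(\<lambda>i. LINT t|F. (?E (Y i) t - ?E z t) / (Y i - z))
        = (\<lambda>i. (laplace F (Y i) - laplace F z) / (Y i - z))"
      using int Y z by (simp add: laplace_eq[OF F])
    finally have "(\<lambda>i. (laplace F (X (i + n0)) - laplace F z) / (X (i + n0) - z)) \<longlonglongrightarrow> d"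
      by (simp add: Y_def)
    from LIMSEQ_offset[OF this]
    show "((\<lambda>w. (laplace F w - laplace F z) / (w - z)) \<circ> X) \<longlonglongrightarrow> d"
      by (simp add: o_def)
  qed
  then show "\<exists>d. (laplace F has_field_derivative d) (at z)"
    by (auto simp: has_field_derivative_iff)
qed

text \<open>
  The functional equation of selfdecomposability is only given on the positive half-line;
  analytic continuation and continuity carry it over to the closed half-plane.
\<close>

lemma laplace_factorization_halfplane:
  assumes F: "nonneg_distribution F" and G: "nonneg_distribution G" and "0 < c"
    and eq: "\<And>s::real. s > 0 \<Longrightarrow> laplace F (of_real s) = laplace F (of_real (c * s)) * laplace G (of_real s)"
    and z: "Re z \<ge> 0"
  shows "laplace F z = laplace F (of_real c * z) * laplace G z"
proof -
  let ?S = "{z. 0 < Re z}"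
  let ?h = "\<lambda>z. laplace F z - laplace F (of_real c * z) * laplace G z"
  have "(laplace F \<circ> (\<lambda>z. of_real c * z)) holomorphic_on ?S"
    by (rule holomorphic_on_compose_gen[OF _ laplace_holomorphic[OF F]])
       (use \<open>0 < c\<close> in \<open>auto intro!: holomorphic_intros\<close>)
  then have holo: "?h holomorphic_on ?S"
    by (intro holomorphic_intros laplace_holomorphic F G) (simp add: o_def)
  \<comment> \<open>Identity theorem: \<open>?h\<close> vanishes on the positive half-line, which
    accumulates at the interior point 1.\<close>
  have open_half: "?h w = 0" if "0 < Re w" for w
  proof (rule analytic_continuation[OF holo open_halfspace_Re_gt, where U = "of_real ` {0<..}" and \<xi> = 1])
    show "connected ?S"
      by (intro convex_connected convex_halfspace_Re_gt)
    have "(\<lambda>n. of_real (1 + 1 / real (Suc n)) :: complex) \<longlonglongrightarrow> of_real (1 + 0)"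
      by (intro tendsto_intros LIMSEQ_Suc[OF lim_1_over_n])
    then show "(1::complex) islimpt of_real ` {0<..}"
      unfolding islimpt_sequential
      by (intro exI[of _ "\<lambda>n. of_real (1 + 1 / real (Suc n))"])
         (auto intro!: imageI add_pos_pos simp del: of_real_add)
    show "?h w = 0" if "w \<in> of_real ` {0<..}" for w
      using that eq by auto
  qed (use that in auto)
  \<comment> \<open>A boundary point is approached from the right, through the open
    half-plane.\<close>
  let ?Z = "\<lambda>n. z + of_real (1 / real (Suc n))"
  have Zlim: "?Z \<longlonglongrightarrow> z + of_real 0"
    by (intro tendsto_intros LIMSEQ_Suc[OF lim_1_over_n])
  have Zpos: "0 < Re (?Z n)" for n
    using z by (simp add: add_nonneg_pos)
  have lim1: "(\<lambda>n. laplace F (?Z n)) \<longlonglongrightarrow> laplace F z"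
    using Zlim Zpos by (intro laplace_tendsto F) (auto intro: less_imp_le)
  have "(\<lambda>n. of_real c * ?Z n) \<longlonglongrightarrow> of_real c * z"
    using tendsto_mult_left[OF Zlim, of "of_real c"] by simp
  moreover have "Re (of_real c * ?Z n) \<ge> 0" for n
    using Zpos[of n] \<open>0 < c\<close> by simp
  ultimately have "(\<lambda>n. laplace F (of_real c * ?Z n)) \<longlonglongrightarrow> laplace F (of_real c * z)"
    by (intro laplace_tendsto F)
  moreover have "(\<lambda>n. laplace G (?Z n)) \<longlonglongrightarrow> laplace G z"
    using Zlim Zpos by (intro laplace_tendsto G) (auto intro: less_imp_le)
  ultimately have "(\<lambda>n. laplace F (of_real c * ?Z n) * laplace G (?Z n)) \<longlonglongrightarrow> laplace F (of_real c * z) * laplace G z"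
    by (rule tendsto_mult)
  moreover have "laplace F (of_real c * ?Z n) * laplace G (?Z n) = laplace F (?Z n)" for n
    using open_half[OF Zpos[of n]] by simp
  ultimately show ?thesis
    using lim1 LIMSEQ_unique by auto
qed

section \<open>Composition of a Laplace transform with the exponent\<close>

text \<open>A characteristic function has modulus at most 1. This places \<open>- L u\<close> in the
  half-plane where Laplace transforms are constrained.\<close>

lemma Re_cont_ln_le_0:
  assumes "char_fun \<omega>" "is_cont_ln \<omega> L"
  shows "Re (L u) \<le> 0"
proof -
  obtain M where "real_distribution M" "\<omega> = char M"
    using assms by (auto simp: char_fun_def)
  then have "norm (exp (L u)) \<le> 1"
    using assms real_distribution.cmod_char_le_1 by (metis is_cont_ln_def)
  then show ?thesis by simp
qed

text \<open>Subordination: this is the characteristic function of the Levy process with exponent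
  \<open>L\<close>, stopped at an independent time with law \<open>F\<close>. Rounding the time down
  to a multiple of \<open>1 / (n + 1)\<close> reduces it to countable mixtures.\<close>

lemma char_fun_laplace_comp:
  assumes F: "nonneg_distribution F" and \<omega>: "inf_divisible \<omega>" and L: "is_cont_ln \<omega> L"
  shows "char_fun (\<lambda>s. laplace F (- L s))"
proof -
  from F interpret F: real_distribution F by (simp add: nonneg_distribution_def)
  have Re: "Re (L u) \<le> 0" for u
    using \<omega> L Re_cont_ln_le_0 by (auto simp: inf_divisible_def)
  define k where "k n t = nat \<lfloor>real (Suc n) * max 0 t\<rfloor>" for n t
  define q where "q n t = real (k n t) / real (Suc n)" for n t
  have [measurable]: "k n \<in> measurable F (count_space UNIV)" for n
    unfolding k_def by measurable
  have q: "(\<lambda>n. q n t) \<longlonglongrightarrow> max 0 t" for t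
  proof (rule Lim_transform_bound[THEN LIM_zero_cancel])
    show "\<forall>\<^sub>F n in sequentially. norm (q n t - max 0 t) \<le> norm (1 / real (Suc n))"
    proof (intro always_eventually allI)
      fix n
      let ?x = "real (Suc n) * max 0 t"
      have "real (k n t) = of_int \<lfloor>?x\<rfloor>"
        by (simp add: k_def)
      then have "\<bar>real (k n t) - ?x\<bar> \<le> 1"
        by linarith
      moreover have "q n t - max 0 t = (real (k n t) - ?x) / real (Suc n)"
        by (simp add: q_def field_simps)
      ultimately show "norm (q n t - max 0 t) \<le> norm (1 / real (Suc n))"
        by (simp add: divide_right_mono)
    qed
    show "(\<lambda>n. 1 / real (Suc n)) \<longlonglongrightarrow> 0"
      by (rule LIMSEQ_Suc[OF lim_1_over_n])
  qed
  \<comment> \<open>A power of the root is the exponential at the rounded time \<open>q n t\<close>,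
    so dominated convergence applies.\<close>
  have step: "exp (L s / of_nat (Suc n)) ^ k n t = exp (L s * of_real (q n t))" for n t s
    by (simp add: q_def mult_ac flip: exp_of_nat_mult)
  show ?thesis
  proof (rule char_fun_limit)
    show "char_fun (\<lambda>s. LINT t|F. exp (L s / of_nat (Suc n)) ^ k n t)" for n
      by (rule char_fun_mixture[where g = "\<lambda>i s. exp (L s / of_nat (Suc n)) ^ i"])
         (auto intro!: char_fun_power char_fun_nth_root[OF \<omega> L] F.prob_space_axioms simp del: of_nat_Suc)
    show "(\<lambda>n. LINT t|F. exp (L s / of_nat (Suc n)) ^ k n t) \<longlonglongrightarrow> laplace F (- L s)" for s
      unfolding laplace_eq[OF F]
    proof (rule integral_dominated_convergence[where w = "\<lambda>_. 1"])
      show "AE t in F. (\<lambda>n. exp (L s / of_nat (Suc n)) ^ k n t) \<longlonglongrightarrow> exp (- (- L s * complex_of_real (max 0 t)))"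
        unfolding step minus_mult_left minus_minus by (intro AE_I2 tendsto_intros q)
      show "AE t in F. norm (exp (L s / of_nat (Suc n)) ^ k n t) \<le> 1" for n
        unfolding step using Re[of s] by (auto simp: q_def mult_nonpos_nonneg divide_nonpos_pos)
    qed auto
    show "isCont (\<lambda>s. laplace F (- L s)) 0"
      unfolding continuous_at_sequentially
    proof safe
      fix X :: "nat \<Rightarrow> real" assume X: "X \<longlonglongrightarrow> 0"
      have "isCont L 0"
        using L by (simp add: is_cont_ln_def continuous_on_eq_continuous_at)
      then have "(\<lambda>n. - L (X n)) \<longlonglongrightarrow> - L 0"
        by (intro tendsto_minus isCont_tendsto_compose[OF _ X])
      then show "((\<lambda>s. laplace F (- L s)) \<circ> X) \<longlonglongrightarrow> laplace F (- L 0)"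
        unfolding o_def by (intro laplace_tendsto F) (auto simp: Re)
    qed
  qed
qed

section \<open>The factorization of the composed law\<close>

theorem mainTheorem2:
  fixes a b :: real and \<omega> :: "real \<Rightarrow> complex" and \<phi> :: "complex \<Rightarrow> complex"
  assumes "0 < b" and "b < 1" and "1 < a"
    and "semi_stable a b \<omega>"
    and "laplace_transform \<phi>"
    and "selfdecomposable \<phi>"
  shows "semi_selfdecomposable b (\<lambda>s. \<phi> (- cont_ln \<omega> s))"
proof -
  from assms(4) obtain \<psi> where \<omega>: "inf_divisible \<omega>" and L: "is_cont_ln \<omega> (\<lambda>u. - \<psi> u)"
    and \<psi>: "\<And>u. \<psi> u = of_real a * \<psi> (b * u)"
    unfolding semi_stable_def by blast
  have Re: "Re (\<psi> u) \<ge> 0" for u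
    using Re_cont_ln_le_0[OF _ L, of u] \<omega> by (simp add: inf_divisible_def)
  have scale: "\<psi> (b * u) = of_real (1 / a) * \<psi> u" for u
    using \<psi>[of u] \<open>1 < a\<close> by simp
  obtain F where F: "nonneg_distribution F" "\<And>z. Re z \<ge> 0 \<Longrightarrow> \<phi> z = laplace F z"
    using assms(5) by (auto simp: laplace_transform_def)
  \<comment> \<open>The ratio is \<open>1 / a\<close>, not \<open>b\<close>: by
    \<open>scale\<close>, shrinking \<open>u\<close> by \<open>b\<close> multiplies the exponent by
    \<open>1 / a\<close>.\<close>
  from \<open>1 < a\<close> have c: "0 < 1 / a" "1 / a < 1" by auto
  with assms(6) obtain \<phi>c where "laplace_transform \<phi>c"
    and eq: "\<And>s::real. s > 0 \<Longrightarrow> \<phi> (of_real s) = \<phi> (of_real (1 / a * s)) * \<phi>c (of_real s)"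
    unfolding selfdecomposable_def by blast
  then obtain G where G: "nonneg_distribution G" "\<And>z. Re z \<ge> 0 \<Longrightarrow> \<phi>c z = laplace G z"
    by (auto simp: laplace_transform_def)
  \<comment> \<open>\<open>\<phi>\<close> and \<open>\<phi>c\<close> are known only on the closed
    half-plane, so the arguments must be checked to lie there.\<close>
  have "laplace F (of_real s) = laplace F (of_real (1 / a * s)) * laplace G (of_real s)"
    if "s > 0" for s :: real
  proof -
    have "0 \<le> Re (of_real s)" "0 \<le> Re (of_real (1 / a * s))"
      using that \<open>1 < a\<close> by auto
    then show ?thesis using eq[OF that] by (metis F(2) G(2))
  qed
  note fact = laplace_factorization_halfplane[OF F(1) G(1) c(1) this]
  have f: "\<phi> (- cont_ln \<omega> s) = laplace F (\<psi> s)" for s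
    using Re by (simp add: cont_ln_eq[OF L] F(2))
  have "char_fun (\<lambda>s. laplace F (\<psi> s))" "char_fun (\<lambda>s. laplace G (\<psi> s))"
    using char_fun_laplace_comp[OF F(1) \<omega> L] char_fun_laplace_comp[OF G(1) \<omega> L] by simp_all
  moreover have "laplace F (\<psi> s) = laplace F (\<psi> (b * s)) * laplace G (\<psi> s)" for s
    unfolding scale by (rule fact[OF _ Re])
  ultimately show ?thesis
    unfolding semi_selfdecomposable_def f by blast
qed

end
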